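(* Let $N(r,3;n)$ denote the number of partitions of $n$ whose rank is congruent to $r$ modulo $3$. Then: (i) for all integers $a,b\ge 12$, $N(0,3;a)\,N(0,3;b) > N(0,3;a+b)$; (ii) for $r\in\{1,2\}$ and all integers $a,b\ge 11$, $N(r,3;a)\,N(r,3;b) > N(r,3;a+b)$.
   Context: A partition of a nonnegative integer $n$ is a finite nonincreasing sequence of positive integers $\lambda=(\lambda_1,\dots,\lambda_k)$ with $\lambda_1+\dots+\lambda_k=n$. The (Dyson) rank of $\lambda$ is $\lambda_1-k$ (largest part minus number of parts). For integers $r$ and $t\ge 1$, $N(r,t;n)$ is the number of partitions of $n$ whose rank is $\equiv r \pmod t$. *)

theory Defs
  imports "HOL-Number_Theory.Cong"
begin

definition partitions_of :: "nat \<Rightarrow> nat list set" where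
  "partitions_of n =
     {p. sorted_wrt (\<ge>) p \<and> (\<forall>x\<in>set p. 0 < x) \<and> sum_list p = n}"

text \<open>The parts are listed in nonincreasing order, so \<open>hd\<close> is the largest part.
  The empty partition (of 0) has no largest part; its rank is 0 by convention.\<close>
definition dyson_rank :: "nat list \<Rightarrow> int" where
  "dyson_rank p = (if p = [] then 0 else int (hd p) - int (length p))"

definition rank_count :: "int \<Rightarrow> nat \<Rightarrow> nat \<Rightarrow> nat" where
  "rank_count r t n = card {p \<in> partitions_of n. [dyson_rank p = r] (mod int t)}"

text \<open>The set counted by \<open>rank_count\<close> is finite, so its \<open>card\<close> is a genuine count.\<close>
lemma finite_partitions_of: "finite (partitions_of n)"
proof (rule finite_subset)
  have len: "length l \<le> sum_list l" if "\<forall>x\<in>set l. 0 < x" for l :: "nat list"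
    using that by (induction l) (auto simp: Suc_le_eq)
  show "partitions_of n \<subseteq> {l. set l \<subseteq> {..n} \<and> length l \<le> n}"
    using len member_le_sum_list by (fastforce simp: partitions_of_def)
  show "finite {l :: nat list. set l \<subseteq> {..n} \<and> length l \<le> n}"
    by (rule finite_lists_length_le) simp
qed

end

theory Submission
  imports Defs "HOL-Library.Multiset" "HOL-Library.FuncSet"
begin

text \<open>
  Write \<open>A\<^sub>r(n)\<close> for \<open>N(r, 3; n)\<close> and \<open>p(n)\<close> for the number of partitions of \<open>n\<close>.

  Enlarging the largest part by 1 raises the rank by 1, and appending a part 1 lowers it by 1.
  By inclusion-exclusion, \<open>A\<^sub>r(n) + A\<^sub>r(n-1) + A\<^sub>r(n-2) - p(n-1)\<close> counts the partitions
  of \<open>n\<close> with rank congruent to \<open>r\<close> that arise in neither way. These numbers are nonnegative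
  and sum over \<open>r\<close> to \<open>p(n) - 2p(n-1) + p(n-2)\<close>; telescoping in steps of 3 yields
  \<open>\<bar>3A\<^sub>r(n) - p(n)\<bar> \<le> 2(p(n) - p(n-1))\<close>.

  The recurrence \<open>n p(n) = \<Sum>\<^sub>k \<sigma>(k) p(n-k)\<close> propagates inequalities that are homogeneous in \<open>p\<close>,
  up to a polynomial error that is eventually dominated by \<open>p\<close>. It gives \<open>p(n+1) \<le> 6/5 p(n)\<close>
  for \<open>n \<ge> 38\<close>, hence \<open>2/9 p(n) \<le> A\<^sub>r(n) \<le> 4/9 p(n)\<close> for \<open>n \<ge> 40\<close>, and then
  \<open>9 p(a+b) < p(a) p(b)\<close> for \<open>a \<ge> 40\<close>, \<open>b \<ge> 13\<close>. This settles \<open>a, b \<ge> 40\<close>. If only \<open>b \<ge> 40\<close>,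
  the bound \<open>p(a+b) \<le> (6/5)\<^sup>a p(b)\<close> reduces the claim to \<open>2 (6/5)\<^sup>a < A\<^sub>r(a)\<close>, and what remains
  is a table of the \<open>A\<^sub>r(n)\<close> with \<open>n \<le> 78\<close>.
\<close>

section \<open>Partitions and rank classes\<close>

lemma Cons_in_partitions_of:
  "x # xs \<in> partitions_of n \<longleftrightarrow>
     0 < x \<and> x \<le> n \<and> (\<forall>y\<in>set xs. y \<le> x) \<and> xs \<in> partitions_of (n - x)"
  by (auto simp: partitions_of_def)

lemma snoc_in_partitions_of:
  assumes "\<forall>x\<in>set xs. s \<le> x" "0 < s"
  shows "xs @ [s] \<in> partitions_of n \<longleftrightarrow> s \<le> n \<and> xs \<in> partitions_of (n - s)"
  using assms by (auto simp: partitions_of_def sorted_wrt_append)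

lemma partitions_of_0: "partitions_of 0 = {[]}"
proof -
  have "p = []" if "p \<in> partitions_of 0" for p
    using that by (cases p) (auto simp: partitions_of_def)
  then show ?thesis by (auto simp: partitions_of_def)
qed

lemma Nil_in_partitions_of: "[] \<in> partitions_of n \<longleftrightarrow> n = 0"
  by (auto simp: partitions_of_def)

definition npart :: "nat \<Rightarrow> int" where
  "npart n = int (card (partitions_of n))"

definition nrank :: "int \<Rightarrow> nat \<Rightarrow> int" where
  "nrank r n = int (rank_count r 3 n)"

lemma nrank_cong: "[r = s] (mod 3) \<Longrightarrow> nrank r n = nrank s n"
  by (simp add: nrank_def rank_count_def cong_def)

lemma npart_eq_sum_nrank: "npart n = nrank 0 n + nrank 1 n + nrank 2 n"
proof -
  let ?P = "\<lambda>r. {p \<in> partitions_of n. [dyson_rank p = r] (mod 3)}"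
  have "partitions_of n = (\<Union>r\<in>{0, 1, 2}. ?P r)"
    by (auto simp: cong_def)
  also have "card \<dots> = (\<Sum>r\<in>{0, 1, 2}. card (?P r))"
    by (rule card_UN_disjoint) (auto simp: finite_partitions_of cong_def)
  finally show ?thesis
    by (simp add: npart_def nrank_def rank_count_def)
qed

text \<open>\<open>U\<close> enlarges the largest part and \<open>V\<close> appends a part 1; both
  are injective here and map into class \<open>r\<close> of \<open>n\<close>. Their images overlap
  only in partitions obtained from class \<open>r\<close> of \<open>n - 2\<close> by applying
  \<open>V\<close> and then \<open>U\<close>.\<close>

lemma nrank_add_le:
  assumes "3 \<le> n"
  shows "nrank (r + 1) (n - 1) + nrank (r - 1) (n - 1) \<le> nrank r n + nrank r (n - 2)"
proof -
  define P where "P r n = {p \<in> partitions_of n. [dyson_rank p = r] (mod 3)}" for r n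
  define U where "U p = Suc (hd p) # tl p" for p :: "nat list"
  define V where "V p = p @ [1]" for p :: "nat list"
  have fin: "finite (P r n)" for r n
    by (simp add: P_def finite_partitions_of)
  have ne: "p \<noteq> []" if "p \<in> P r m" "0 < m" for p r m
    using that by (auto simp: P_def partitions_of_def)
  have "inj_on U (P (r - 1) (n - 1))"
  proof (rule inj_onI)
    fix x y assume "x \<in> P (r - 1) (n - 1)" "y \<in> P (r - 1) (n - 1)" and eq: "U x = U y"
    then have "x \<noteq> []" "y \<noteq> []"
      using ne[of _ "r - 1" "n - 1"] assms by auto
    then show "x = y"
      using eq by (cases x; cases y) (auto simp: U_def)
  qed
  then have cU: "card (U ` P (r - 1) (n - 1)) = card (P (r - 1) (n - 1))"
    by (rule card_image)
  have cV: "card (V ` P (r + 1) (n - 1)) = card (P (r + 1) (n - 1))"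
    by (rule card_image) (auto simp: inj_on_def V_def)
  have "U p \<in> P r n" if p: "p \<in> P (r - 1) (n - 1)" for p
  proof -
    obtain x xs where xs: "p = x # xs"
      using ne[OF p] assms by (cases p) auto
    have "[dyson_rank p + 1 = r - 1 + 1] (mod 3)"
      using p by (intro cong_add) (auto simp: P_def)
    moreover have "dyson_rank (U p) = dyson_rank p + 1"
      by (simp add: dyson_rank_def U_def xs)
    moreover have "U p \<in> partitions_of n"
      using p assms by (auto simp: P_def U_def xs Cons_in_partitions_of)
    ultimately show ?thesis by (simp add: P_def)
  qed
  moreover have "V p \<in> P r n" if p: "p \<in> P (r + 1) (n - 1)" for p
  proof -
    have "[dyson_rank p - 1 = (r + 1) - 1] (mod 3)"
      using p by (intro cong_diff) (auto simp: P_def)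
    moreover have "dyson_rank (V p) = dyson_rank p - 1"
      using ne[OF p] assms by (simp add: dyson_rank_def V_def)
    moreover have "p \<in> partitions_of (n - 1)" using p by (simp add: P_def)
    then have "V p \<in> partitions_of n"
      unfolding V_def using assms
      by (subst snoc_in_partitions_of) (simp_all add: partitions_of_def Suc_le_eq)
    ultimately show ?thesis by (simp add: P_def)
  qed
  ultimately have "U ` P (r - 1) (n - 1) \<union> V ` P (r + 1) (n - 1) \<subseteq> P r n"
    by blast
  then have un: "card (U ` P (r - 1) (n - 1) \<union> V ` P (r + 1) (n - 1)) \<le> card (P r n)"
    by (intro card_mono fin)
  have "U ` P (r - 1) (n - 1) \<inter> V ` P (r + 1) (n - 1) \<subseteq> (U \<circ> V) ` P r (n - 2)"
  proof
    fix q assume q: "q \<in> U ` P (r - 1) (n - 1) \<inter> V ` P (r + 1) (n - 1)"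
    then obtain p p' where p: "p \<in> P (r - 1) (n - 1)" "q = U p"
      and p': "p' \<in> P (r + 1) (n - 1)" "q = V p'" by blast
    obtain x xs where xs: "p = x # xs"
      using ne[OF p(1)] assms by (cases p) auto
    \<comment> \<open>Since \<open>p'\<close> is nonempty, the enlarged head and the appended 1 are
      different entries, so both changes can be undone at once.\<close>
    obtain ys where ys: "p' = Suc x # ys" "xs = ys @ [1]"
      using p p' ne[OF p'(1)] assms by (cases p') (auto simp: U_def V_def xs)
    have "x # ys \<in> partitions_of (n - 2)"
      using p(1) assms by (auto simp: P_def xs ys partitions_of_def sorted_wrt_append)
    moreover have "dyson_rank (x # ys) = dyson_rank p + 1"
      by (simp add: dyson_rank_def xs ys)
    moreover have "[dyson_rank p + 1 = r - 1 + 1] (mod 3)"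
      using p(1) by (intro cong_add) (auto simp: P_def)
    ultimately have "x # ys \<in> P r (n - 2)"
      by (simp add: P_def)
    moreover have "q = (U \<circ> V) (x # ys)"
      by (simp add: p(2) U_def V_def xs ys)
    ultimately show "q \<in> (U \<circ> V) ` P r (n - 2)" by blast
  qed
  then have "card (U ` P (r - 1) (n - 1) \<inter> V ` P (r + 1) (n - 1)) \<le> card ((U \<circ> V) ` P r (n - 2))"
    by (intro card_mono finite_imageI fin)
  also have "\<dots> \<le> card (P r (n - 2))"
    by (intro card_image_le fin)
  finally have "card (U ` P (r - 1) (n - 1)) + card (V ` P (r + 1) (n - 1)) \<le>
      card (P r n) + card (P r (n - 2))"
    using un card_Un_Int[of "U ` P (r - 1) (n - 1)" "V ` P (r + 1) (n - 1)"] fin by simp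
  then show ?thesis
    unfolding cU cV by (simp add: nrank_def rank_count_def P_def)
qed

text \<open>Modulo 3, \<open>r - 1\<close> and \<open>r + 1\<close> are the other two classes;
  adding class \<open>r\<close> of \<open>n - 1\<close> to both sides of \<open>nrank_add_le\<close>
  completes the sum to \<open>npart (n - 1)\<close>.\<close>

lemma nrank_three_term_ge:
  assumes "3 \<le> n" "r \<in> {0, 1, 2}"
  shows "npart (n - 1) \<le> nrank r n + nrank r (n - 1) + nrank r (n - 2)"
proof -
  have "nrank 3 m = nrank 0 m" "nrank (-1) m = nrank 2 m" for m
    by (rule nrank_cong, simp add: cong_def)+
  then show ?thesis
    using nrank_add_le[OF assms(1), of r] assms(2) npart_eq_sum_nrank[of "n - 1"] by auto
qed

text \<open>The three defects in \<open>nrank_three_term_ge\<close> are nonnegative with sum p(n) -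
  2p(n-1) + p(n-2), which therefore bounds each of them.\<close>

lemma nrank_three_term_le:
  assumes "3 \<le> n" "r \<in> {0, 1, 2}"
  shows "nrank r n + nrank r (n - 1) + nrank r (n - 2) \<le> npart n - npart (n - 1) + npart (n - 2)"
  using assms(2) nrank_three_term_ge[OF assms(1), of 0] nrank_three_term_ge[OF assms(1), of 1]
    nrank_three_term_ge[OF assms(1), of 2] npart_eq_sum_nrank[of n] npart_eq_sum_nrank[of "n - 1"]
    npart_eq_sum_nrank[of "n - 2"] by auto

lemma npart_convex: "3 \<le> n \<Longrightarrow> 2 * npart (n - 1) \<le> npart n + npart (n - 2)"
  using nrank_three_term_ge[of n 0] nrank_three_term_le[of n 0] by simp

section \<open>Tabulating the rank classes\<close>

text \<open>
  Solves \<open>y\<^sub>n = f x\<^sub>n y\<^bsub>n-k\<^esub>\<close> along a list. The last \<open>k\<close> results are kept in a queue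
  \<open>q @ rev b\<close>, which makes every step of the evaluation cheap.
\<close>
fun feed :: "('a \<Rightarrow> 'a \<Rightarrow> 'a) \<Rightarrow> 'a list \<Rightarrow> 'a list \<Rightarrow> 'a list \<Rightarrow> 'a list" where
  "feed f q b [] = []"
| "feed f (y # q) b (x # xs) = (let z = f x y in z # feed f q (z # b) xs)"
| "feed f [] b (x # xs) =
     (case rev b of [] \<Rightarrow> x # xs | y # q \<Rightarrow> let z = f x y in z # feed f q [z] xs)"

text \<open>\<open>h\<close> is \<open>g'\<close> delayed by \<open>k\<close> places behind
  \<open>k\<close> initial values. Invariant: the queue holds the next \<open>k\<close> values of
  \<open>h\<close>; as \<open>0 < k\<close>, it never runs empty.\<close>

lemma feed_correct:
  assumes "\<And>n. g' n = f (g n) (h n)" "0 < k" "\<And>n. h (n + k) = g' n"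
    "q @ rev b = map h [i..<i + k]" "i \<le> l"
  shows "feed f q b (map g [i..<l]) = map g' [i..<l]"
  using assms(4,5)
proof (induction "l - i" arbitrary: i q b)
  case 0
  then show ?case by simp
next
  case (Suc d)
  have i: "[i..<l] = i # [Suc i..<l]"
    using Suc.hyps(2) by (simp add: upt_rec)
  have h: "map h [i..<i + k] = h i # map h [Suc i..<i + k]"
    using assms(2) by (simp add: upt_rec)
  have last: "map h [Suc i..<Suc i + k] = map h [Suc i..<i + k] @ [g' i]"
    using assms(2,3) by (simp add: upt_Suc)
  have step: "feed f q' b' (map g [Suc i..<l]) = map g' [Suc i..<l]"
    if "q' @ rev b' = map h [Suc i..<i + k] @ [g' i]" for q' b'
    using Suc.hyps(2) that by (intro Suc.hyps(1)) (simp only: last | linarith)+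
  show ?case
  proof (cases q)
    case (Cons y q')
    then have "y = h i" "q' @ rev b = map h [Suc i..<i + k]"
      using Suc.prems(1) h by auto
    then show ?thesis
      using step[of q' "g' i # b"] by (simp add: Cons i Let_def flip: assms(1))
  next
    case Nil
    then have "rev b = h i # map h [Suc i..<i + k]"
      using Suc.prems(1) h by auto
    then show ?thesis
      using step[of "map h [Suc i..<i + k]" "[g' i]"] by (simp add: Nil i Let_def flip: assms(1))
  qed
qed

text \<open>If the part \<open>Suc m\<close> occurs, it is the head and can be removed.
  \<open>Q\<close> stays arbitrary so that one split serves both statistics below.\<close>

lemma card_bounded_partitions:
  "card {p \<in> partitions_of n. set p \<subseteq> {..Suc m} \<and> Q p} =
     card {p \<in> partitions_of n. set p \<subseteq> {..m} \<and> Q p} +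
     (if Suc m \<le> n
      then card {p \<in> partitions_of (n - Suc m). set p \<subseteq> {..Suc m} \<and> Q (Suc m # p)} else 0)"
proof -
  define B where "B = (if Suc m \<le> n
    then {p \<in> partitions_of (n - Suc m). set p \<subseteq> {..Suc m} \<and> Q (Suc m # p)} else {})"
  let ?P = "\<lambda>m. {p \<in> partitions_of n. set p \<subseteq> {..m} \<and> Q p}"
  have fin: "finite (?P m)" "finite B" for m
    by (simp_all add: B_def finite_partitions_of)
  have "?P (Suc m) = ?P m \<union> Cons (Suc m) ` B"
  proof (intro equalityI subsetI)
    fix p assume p: "p \<in> ?P (Suc m)"
    show "p \<in> ?P m \<union> Cons (Suc m) ` B"
    proof (cases "Suc m \<in> set p")
      case True
      then obtain x xs where xs: "p = x # xs" by (cases p) auto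
      then have "x = Suc m" "Suc m \<le> n"
        using p True by (auto simp: Cons_in_partitions_of intro: le_antisym)
      then show ?thesis
        using p by (auto simp: xs B_def Cons_in_partitions_of)
    next
      case False
      then have "set p \<subseteq> {..m}" using p by (auto simp: le_Suc_eq)
      then show ?thesis using p by blast
    qed
  next
    fix p assume "p \<in> ?P m \<union> Cons (Suc m) ` B"
    then show "p \<in> ?P (Suc m)"
      by (auto simp: B_def Cons_in_partitions_of subset_iff split: if_splits)
  qed
  moreover have "?P m \<inter> Cons (Suc m) ` B = {}" by auto
  ultimately have "card (?P (Suc m)) = card (?P m) + card (Cons (Suc m) ` B)"
    using fin by (simp add: card_Un_disjoint)
  also have "card (Cons (Suc m) ` B) = card B"
    by (simp add: card_image)
  finally show ?thesis by (simp add: B_def)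
qed

text \<open>
  Counting by \<open>m - length p\<close> rather than by \<open>length p\<close> gives the recurrences of
  \<open>bounded_colength\<close> and \<open>bounded_nrank\<close> the same second summand.
\<close>
definition bounded_colength :: "nat \<Rightarrow> nat \<Rightarrow> int \<Rightarrow> int" where
  "bounded_colength m n r =
     int (card {p \<in> partitions_of n. set p \<subseteq> {..m} \<and> [int m - int (length p) = r] (mod 3)})"

definition bounded_nrank :: "nat \<Rightarrow> nat \<Rightarrow> int \<Rightarrow> int" where
  "bounded_nrank m n r =
     int (card {p \<in> partitions_of n. set p \<subseteq> {..m} \<and> [dyson_rank p = r] (mod 3)})"

lemma bounded_colength_Suc:
  "bounded_colength (Suc m) n r = bounded_colength m n (r - 1) +
     (if Suc m \<le> n then bounded_colength (Suc m) (n - Suc m) (r + 1) else 0)"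
proof -
  have "[int (Suc m) - l = r] (mod 3) \<longleftrightarrow> [int m - l = r - 1] (mod 3)"
    "[int (Suc m) - int (length (Suc m # p)) = r] (mod 3) \<longleftrightarrow>
     [int (Suc m) - int (length p) = r + 1] (mod 3)" for l p
    by (simp_all add: cong_iff_dvd_diff algebra_simps)
  then show ?thesis
    unfolding bounded_colength_def by (subst card_bounded_partitions) simp
qed

text \<open>Once the head is \<open>Suc m\<close>, the rank is \<open>Suc m\<close> minus the
  length, so the colength count takes over.\<close>

lemma bounded_nrank_Suc:
  "bounded_nrank (Suc m) n r = bounded_nrank m n r +
     (if Suc m \<le> n then bounded_colength (Suc m) (n - Suc m) (r + 1) else 0)"
proof -
  have "[dyson_rank (Suc m # p) = r] (mod 3) \<longleftrightarrow>
      [int (Suc m) - int (length p) = r + 1] (mod 3)" for p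
    unfolding cong_iff_dvd_diff by (simp add: dyson_rank_def algebra_simps)
  then show ?thesis
    unfolding bounded_colength_def bounded_nrank_def
    by (subst card_bounded_partitions) (simp only: of_nat_add of_nat_0 split: if_split, simp)
qed

type_synonym entry = "int \<times> int \<times> int \<times> int \<times> int \<times> int"

definition rank_entry :: "nat \<Rightarrow> nat \<Rightarrow> entry" where
  "rank_entry m n = (bounded_colength m n 0, bounded_colength m n 1, bounded_colength m n 2,
     bounded_nrank m n 0, bounded_nrank m n 1, bounded_nrank m n 2)"

text \<open>The shifts \<open>r - 1\<close> (for \<open>v\<close>) and \<open>r + 1\<close> (for
  \<open>w\<close>) of the two recurrences, read cyclically modulo 3.\<close>

fun rank_step :: "entry \<Rightarrow> entry \<Rightarrow> entry" where
  "rank_step (v0, v1, v2, k0, k1, k2) (w0, w1, w2, _) =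
     (v2 + w1, v0 + w2, v1 + w0, k0 + w1, k1 + w2, k2 + w0)"

primrec rank_row :: "nat \<Rightarrow> nat \<Rightarrow> entry list" where
  "rank_row L 0 = (1, 0, 0, 1, 0, 0) # replicate L (0, 0, 0, 0, 0, 0)"
| "rank_row L (Suc m) = feed rank_step (replicate (Suc m) (0, 0, 0, 0, 0, 0)) [] (rank_row L m)"

lemma rank_entry_Suc:
  "rank_entry (Suc m) n = rank_step (rank_entry m n)
     (if n < Suc m then (0, 0, 0, 0, 0, 0) else rank_entry (Suc m) (n - Suc m))"
proof -
  have "bounded_colength m n (-1) = bounded_colength m n 2"
    "bounded_colength (Suc m) (n - Suc m) 3 = bounded_colength (Suc m) (n - Suc m) 0"
    by (simp_all add: bounded_colength_def cong_def)
  then show ?thesis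
    using bounded_colength_Suc[of m n 0] bounded_colength_Suc[of m n 1] bounded_colength_Suc[of m n 2]
      bounded_nrank_Suc[of m n 0] bounded_nrank_Suc[of m n 1] bounded_nrank_Suc[of m n 2]
    by (cases "n < Suc m") (simp_all add: rank_entry_def)
qed

lemma rank_entry_0: "rank_entry 0 n = (if n = 0 then (1, 0, 0, 1, 0, 0) else (0, 0, 0, 0, 0, 0))"
proof -
  have "p = []" if "p \<in> partitions_of n" "set p \<subseteq> {..0}" for p
    using that by (cases p) (auto simp: partitions_of_def)
  then have "p \<in> partitions_of n \<and> set p \<subseteq> {..0} \<and> Q p \<longleftrightarrow> p = [] \<and> n = 0 \<and> Q []" for p Q
    using Nil_in_partitions_of by (metis empty_subsetI list.set(1))
  then have "{p \<in> partitions_of n. set p \<subseteq> {..0} \<and> Q p} = {p. p = [] \<and> n = 0 \<and> Q []}" for Q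
    by (simp only:)
  then show ?thesis
    by (simp add: rank_entry_def bounded_colength_def bounded_nrank_def dyson_rank_def cong_def)
qed

lemma rank_row_eq: "rank_row L m = map (rank_entry m) [0..<Suc L]"
proof (induction m)
  case 0
  have "map (rank_entry 0) [0..<Suc L] = rank_entry 0 0 # map (rank_entry 0) [1..<Suc L]"
    by (simp add: upt_conv_Cons del: upt_Suc)
  also have "map (rank_entry 0) [1..<Suc L] = replicate L (0, 0, 0, 0, 0, 0)"
    by (rule nth_equalityI) (auto simp: rank_entry_0 simp del: upt_Suc)
  finally show ?case by (simp add: rank_entry_0)
next
  case (Suc m)
  let ?h = "\<lambda>n. if n < Suc m then (0, 0, 0, 0, 0, 0) else rank_entry (Suc m) (n - Suc m)"
  have "replicate (Suc m) (0, 0, 0, 0, 0, 0) = map ?h [0..<Suc m]"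
    by (rule nth_equalityI) (auto simp del: upt_Suc replicate_Suc)
  then have "feed rank_step (replicate (Suc m) (0, 0, 0, 0, 0, 0)) [] (map (rank_entry m) [0..<Suc L])
      = map (rank_entry (Suc m)) [0..<Suc L]"
    by (intro feed_correct[where h = ?h and k = "Suc m"] rank_entry_Suc) simp_all
  then show ?case by (simp only: rank_row.simps Suc.IH)
qed

text \<open>The last index 78 is the largest sum of two arguments below 40.\<close>

definition rank_table :: "(int \<times> int \<times> int) list" where
  "rank_table =
    [(1, 0, 0), (1, 0, 0), (0, 1, 1), (1, 1, 1), (3, 1, 1), (1, 3, 3), (3, 4, 4), (7, 4, 4),
     (6, 8, 8), (10, 10, 10), (16, 13, 13), (16, 20, 20), (25, 26, 26), (37, 32, 32),
     (43, 46, 46), (58, 59, 59), (81, 75, 75), (95, 101, 101), (127, 129, 129),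
     (168, 161, 161), (205, 211, 211), (264, 264, 264), (340, 331, 331), (413, 421, 421),
     (523, 526, 526), (660, 649, 649), (806, 815, 815), (1002, 1004, 1004), (1248, 1235, 1235),
     (1513, 1526, 1526), (1866, 1869, 1869), (2292, 2275, 2275), (2775, 2787, 2787),
     (3379, 3382, 3382), (4116, 4097, 4097), (4949, 4967, 4967), (5989, 5994, 5994),
     (7227, 7205, 7205), (8659, 8678, 8678), (10393, 10396, 10396), (12464, 12437, 12437),
     (14845, 14869, 14869), (17720, 17727, 17727), (21109, 21076, 21076),
     (25041, 25067, 25067), (29708, 29713, 29713), (35210, 35174, 35174),
     (41562, 41596, 41596), (49085, 49094, 49094), (57871, 57827, 57827),
     (68052, 68087, 68087), (79975, 79984, 79984), (93897, 93846, 93846),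
     (109947, 109992, 109992), (128711, 128722, 128722), (150464, 150406, 150406),
     (175575, 175624, 175624), (204712, 204721, 204721), (238452, 238384, 238384),
     (277234, 277293, 277293), (322145, 322161, 322161), (373887, 373809, 373809),
     (433342, 433407, 433407), (501823, 501838, 501838), (580602, 580514, 580514),
     (670800, 670879, 670879), (774494, 774513, 774513), (893299, 893195, 893195),
     (1029189, 1029273, 1029273), (1184769, 1184788, 1184788), (1362734, 1362617, 1362617),
     (1565667, 1565769, 1565769), (1797577, 1797603, 1797603), (2061985, 2061852, 2061852),
     (2363092, 2363204, 2363204), (2706072, 2706096, 2706096), (3096465, 3096313, 3096313),
     (3539867, 3539998, 3539998), (4044032, 4044066, 4044066)]"

lemma rank_table_eq: "rank_table = map (snd \<circ> snd \<circ> snd) (rank_row 78 78)"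
  by code_simp

lemma nth_rank_table:
  assumes "n \<le> 78"
  shows "rank_table ! n = (nrank 0 n, nrank 1 n, nrank 2 n)"
proof -
  \<comment> \<open>For \<open>n \<le> 78\<close> the bound 78 on the parts is no restriction, so
    row 78 counts all partitions.\<close>
  have "set p \<subseteq> {..78}" if "p \<in> partitions_of n" for p
    using that assms member_le_sum_list[of _ p] by (force simp: partitions_of_def)
  then have "{p \<in> partitions_of n. set p \<subseteq> {..78} \<and> [dyson_rank p = r] (mod 3)} =
      {p \<in> partitions_of n. [dyson_rank p = r] (mod 3)}" for r
    by blast
  then have "bounded_nrank 78 n r = nrank r n" for r
    by (simp add: bounded_nrank_def nrank_def rank_count_def)
  then show ?thesis
    using assms by (simp add: rank_table_eq rank_row_eq rank_entry_def del: upt_Suc)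
qed

lemma nrank_table:
  "map (nrank 0) [0..<79] = map fst rank_table"
  "map (nrank 1) [0..<79] = map (fst \<circ> snd) rank_table"
  "map (nrank 2) [0..<79] = map (snd \<circ> snd) rank_table"
proof -
  have len: "length rank_table = 79" by (simp add: rank_table_def)
  show "map (nrank 0) [0..<79] = map fst rank_table"
    "map (nrank 1) [0..<79] = map (fst \<circ> snd) rank_table"
    "map (nrank 2) [0..<79] = map (snd \<circ> snd) rank_table"
    by (rule nth_equalityI; simp add: len nth_rank_table del: upt_Suc)+
qed

text \<open>Splits off 0 and 1, which are not of the form \<open>numeral\<close>, so that
  simplification can unfold the rest.\<close>

lemma upt_0_conv_Cons_Cons: "2 \<le> n \<Longrightarrow> [0..<n] = 0 # 1 # [2..<n]"
  by (subst upt_conv_Cons, simp, subst upt_conv_Cons, simp, simp only: One_nat_def numeral_2_eq_2)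

lemmas nrank_values =
  nrank_table[unfolded rank_table_def upt_0_conv_Cons_Cons[of 79, simplified], simplified]

lemma npart_table: "map npart [0..<79] = map (\<lambda>(a, b, c). a + b + c) rank_table"
proof (rule nth_equalityI)
  have len: "length rank_table = 79" by (simp add: rank_table_def)
  show "length (map npart [0..<79]) = length (map (\<lambda>(a, b, c). a + b + c) rank_table)"
    by (simp add: len)
  show "map npart [0..<79] ! n = map (\<lambda>(a, b, c). a + b + c) rank_table ! n"
    if "n < length (map npart [0..<79])" for n
    using that by (simp add: len nth_rank_table npart_eq_sum_nrank del: upt_Suc)
qed

lemmas npart_values =
  npart_table[unfolded rank_table_def upt_0_conv_Cons_Cons[of 79, simplified], simplified]

text \<open>In order: the initial range of \<open>npart_ratio\<close>, that of
  \<open>npart_gt_quadratic\<close>, and the two ranges of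
  \<open>npart_product_small\<close>.\<close>

lemma npart_checks:
  "\<forall>n\<in>{38..<72}. 5 * npart (n + 1) \<le> 6 * npart n"
  "\<forall>b\<in>{40..<72}. 21 * (int b)\<^sup>2 + 12 * int b < npart b"
  "\<forall>i\<in>{0..<13}. 9 * 6 ^ i \<le> 5 ^ i * (npart i + 18)"
  "\<forall>i\<in>{13..<40}. 9 * 6 ^ i < 5 ^ i * npart i"
  unfolding set_upt[symmetric] by (simp_all add: npart_values upt_0_conv_Cons_Cons)

text \<open>The total amount by which the ratio bound 6/5 fails below 38; it enters the error term
  of \<open>npart_ratio\<close>.\<close>

lemma npart_excess_sum: "(\<Sum>i\<in>{0..<38}. max 0 (5 * npart (i + 1) - 6 * npart i)) = 9301"
  unfolding interv_sum_list_conv_sum_set_nat[symmetric] set_upt[symmetric]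
  by (simp add: npart_values upt_0_conv_Cons_Cons flip: numeral_2_eq_2)

lemma nrank_checks:
  "\<forall>a\<in>{12..<40}. 2 * 6 ^ a < 5 ^ a * nrank 0 a"
  "\<forall>a\<in>{11..<40}. 2 * 6 ^ a < 5 ^ a * nrank 1 a"
  "\<forall>a\<in>{11..<40}. 2 * 6 ^ a < 5 ^ a * nrank 2 a"
  unfolding set_upt[symmetric] by (simp_all add: nrank_values)

lemma nrank_product_checks:
  "\<forall>a\<in>{12..<40}. \<forall>b\<in>{12..<40}. nrank 0 (a + b) < nrank 0 a * nrank 0 b"
  "\<forall>a\<in>{11..<40}. \<forall>b\<in>{11..<40}. nrank 1 (a + b) < nrank 1 a * nrank 1 b"
  "\<forall>a\<in>{11..<40}. \<forall>b\<in>{11..<40}. nrank 2 (a + b) < nrank 2 a * nrank 2 b"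
  unfolding set_upt[symmetric] by (simp_all add: nrank_values)

section \<open>Near equidistribution of the rank modulo 3\<close>

lemma nrank_near_third:
  assumes "2 \<le> n" "r \<in> {0, 1, 2}"
  shows "\<bar>3 * nrank r n - npart n\<bar> \<le> 2 * (npart n - npart (n - 1))"
  using assms(1)
proof (induction n rule: less_induct)
  case (less n)
  show ?case
  proof (cases "n \<le> 4")
    case True
    then have "n = 2 \<or> n = 3 \<or> n = 4" using less.prems by auto
    then show ?thesis using assms(2) by (auto simp: npart_values nrank_values)
  next
    case False
    define m where "m = n - 5"
    have n: "n = m + 5" using False by (simp add: m_def)
    have IH: "\<bar>3 * nrank r (m + 2) - npart (m + 2)\<bar> \<le> 2 * (npart (m + 2) - npart (m + 1))"
      using less.IH[of "m + 2"] by (simp add: n)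
    have sub: "m + 4 - 1 = m + 3" "m + 4 - 2 = m + 2" "m + 5 - 1 = m + 4" "m + 5 - 2 = m + 3"
      "m + 3 - 1 = m + 2" "m + 3 - 2 = m + 1"
      by simp_all
    have le: "3 \<le> m + 3" "3 \<le> m + 4" "3 \<le> m + 5" by simp_all
    \<comment> \<open>Let d(n) = p(n) - p(n-1). Subtracting the three-term sums at m+4 and m+5 puts
      A(m+5) - A(m+2) between d(m+3) and d(m+5), where A is class \<open>r\<close>. Together with
      \<open>IH\<close> and the monotonicity of d from m+2 to m+5 this closes the step.\<close>
    have "\<bar>3 * nrank r (m + 5) - npart (m + 5)\<bar> \<le> 2 * (npart (m + 5) - npart (m + 4))"
      using IH nrank_three_term_ge[OF le(2) assms(2), unfolded sub]
        nrank_three_term_ge[OF le(3) assms(2), unfolded sub]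
        nrank_three_term_le[OF le(2) assms(2), unfolded sub]
        nrank_three_term_le[OF le(3) assms(2), unfolded sub]
        npart_convex[OF le(1), unfolded sub]
      by (smt (verit))
    moreover have "n - 1 = m + 4" using n by simp
    ultimately show ?thesis by (simp only: n)
  qed
qed

section \<open>Growth of the partition function\<close>

definition npart_ge :: "nat \<Rightarrow> nat \<Rightarrow> int" where
  "npart_ge s n = int (card {p \<in> partitions_of n. \<forall>x\<in>set p. s \<le> x})"

lemma npart_ge_rec:
  assumes "0 < s" "s \<le> n"
  shows "npart_ge s n = npart_ge (Suc s) n + npart_ge s (n - s)"
proof -
  define Q where "Q s n = {p \<in> partitions_of n. \<forall>x\<in>set p. s \<le> x}" for s n
  have fin: "finite (Q s n)" for s n
    by (simp add: Q_def finite_partitions_of)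
  have "Q s n = Q (Suc s) n \<union> (\<lambda>p. p @ [s]) ` Q s (n - s)"
  proof (intro equalityI subsetI)
    fix p assume p: "p \<in> Q s n"
    show "p \<in> Q (Suc s) n \<union> (\<lambda>p. p @ [s]) ` Q s (n - s)"
    proof (cases "s \<in> set p")
      case True
      then obtain xs x where xs: "p = xs @ [x]"
        by (cases p rule: rev_cases) auto
      have "x = s"
        using p True by (auto simp: Q_def partitions_of_def xs sorted_wrt_append intro: le_antisym)
      then show ?thesis
        using p snoc_in_partitions_of[of xs s n] assms by (auto simp: Q_def xs)
    next
      case False
      then show ?thesis using p by (auto simp: Q_def Suc_le_eq le_less)
    qed
  next
    fix p assume "p \<in> Q (Suc s) n \<union> (\<lambda>p. p @ [s]) ` Q s (n - s)"
    then show "p \<in> Q s n"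
      using assms snoc_in_partitions_of by (auto simp: Q_def)
  qed
  moreover have "card (Q (Suc s) n \<union> (\<lambda>p. p @ [s]) ` Q s (n - s)) =
      card (Q (Suc s) n) + card ((\<lambda>p. p @ [s]) ` Q s (n - s))"
    by (rule card_Un_disjoint) (auto simp: fin, auto simp: Q_def)
  moreover have "card ((\<lambda>p. p @ [s]) ` Q s (n - s)) = card (Q s (n - s))"
    by (rule card_image) (auto simp: inj_on_def)
  ultimately show ?thesis by (simp add: npart_ge_def Q_def)
qed

text \<open>Enlarging the largest part is injective and keeps all parts at least \<open>s\<close>;
  \<open>0 < m\<close> ensures that a largest part exists.\<close>

lemma npart_ge_mono:
  assumes "0 < m" "m \<le> n"
  shows "npart_ge s m \<le> npart_ge s n"
  using assms(2)
proof (induction n rule: dec_induct)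
  case (step n)
  let ?Q = "\<lambda>n. {p \<in> partitions_of n. \<forall>x\<in>set p. s \<le> x}"
  let ?U = "\<lambda>p :: nat list. Suc (hd p) # tl p"
  have ne: "p \<noteq> []" if "p \<in> ?Q n" for p
    using that step assms by (auto simp: partitions_of_def)
  have "inj_on ?U (?Q n)"
  proof (rule inj_onI)
    fix p q assume "p \<in> ?Q n" "q \<in> ?Q n" and eq: "?U p = ?U q"
    then have "p \<noteq> []" "q \<noteq> []" using ne by blast+
    then show "p = q" using eq by (cases p; cases q) auto
  qed
  moreover have "?U ` ?Q n \<subseteq> ?Q (Suc n)"
  proof
    fix q assume "q \<in> ?U ` ?Q n"
    then obtain p where p: "p \<in> ?Q n" "q = ?U p" by blast
    then show "q \<in> ?Q (Suc n)"
      using ne[OF p(1)] by (cases p) (auto simp: Cons_in_partitions_of)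
  qed
  ultimately have "card (?Q n) \<le> card (?Q (Suc n))"
    by (rule card_inj_on_le) (simp add: finite_partitions_of)
  then show ?case using step by (simp add: npart_ge_def)
qed simp

lemma npart_eq_npart_ge: "npart n = npart_ge 1 n"
proof -
  have "partitions_of n = {p \<in> partitions_of n. \<forall>x\<in>set p. 1 \<le> x}"
    by (auto simp: partitions_of_def Suc_le_eq)
  then show ?thesis by (simp add: npart_def npart_ge_def)
qed

lemma npart_mono: "m \<le> n \<Longrightarrow> npart m \<le> npart n"
proof (induction n rule: dec_induct)
  case (step n)
  have "0 \<le> npart_ge 2 (Suc n)" by (simp add: npart_ge_def)
  then show ?case
    using step npart_ge_rec[of 1 "Suc n"] by (simp add: npart_eq_npart_ge numeral_2_eq_2)
qed simp

text \<open>The expression is the coefficient of q^n in (1 - q)(1 - q^2) times the generating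
  function of p. It counts the partitions without parts 1 and 2, and \<open>npart_ge_mono\<close>
  applies.\<close>

lemma npart_second_difference_mono:
  assumes "3 \<le> m" "m \<le> n"
  shows "npart m - npart (m - 1) - (npart (m - 2) - npart (m - 3))
    \<le> npart n - npart (n - 1) - (npart (n - 2) - npart (n - 3))"
proof -
  have "npart n - npart (n - 1) - (npart (n - 2) - npart (n - 3)) = npart_ge 3 n" if "3 \<le> n" for n
  proof -
    have "npart_ge 1 n = npart_ge 2 n + npart_ge 1 (n - 1)"
      using npart_ge_rec[of 1 n] that by (simp add: numeral_eq_Suc)
    moreover have "npart_ge 1 (n - 2) = npart_ge 2 (n - 2) + npart_ge 1 (n - 3)"
      using npart_ge_rec[of 1 "n - 2"] that by (simp add: numeral_eq_Suc)
    moreover have "npart_ge 2 n = npart_ge 3 n + npart_ge 2 (n - 2)"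
      using npart_ge_rec[of 2 n] that by (simp add: numeral_eq_Suc)
    ultimately show ?thesis by (simp add: npart_eq_npart_ge)
  qed
  then show ?thesis using npart_ge_mono[of m n 3] assms by simp
qed

lemma npart_ge_quadratic:
  assumes "72 \<le> n"
  shows "1000 * (int n)\<^sup>2 \<le> npart n"
proof -
  \<comment> \<open>Induction in steps of 2: d(n) - d(n-2), with d(n) = p(n) - p(n-1), is at least
    its value 161955 at n = 72, well above the required 8000.\<close>
  have d: "4000 * int n \<le> npart n - npart (n - 1)" if "72 \<le> n" for n
    using that
  proof (induction n rule: less_induct)
    case (less n)
    show ?case
    proof (cases "n \<le> 73")
      case True
      then have "n = 72 \<or> n = 73" using less.prems by auto
      then show ?thesis by (auto simp: npart_values)
    next
      case False
      have "4000 * int (n - 2) \<le> npart (n - 2) - npart (n - 2 - 1)"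
        using False by (intro less.IH) auto
      moreover have "n - 2 - 1 = n - 3" "int (n - 2) = int n - 2" using False by auto
      ultimately show ?thesis
        using npart_second_difference_mono[of 72 n] False by (simp add: npart_values)
    qed
  qed
  show ?thesis using assms
  proof (induction n rule: dec_induct)
    case base
    \<comment> \<open>p(72) = 5392783 narrowly exceeds 1000 * 72^2 = 5184000.\<close>
    show ?case by (simp add: npart_values)
  next
    case (step n)
    then show ?case using d[of "Suc n"] by (simp add: power2_eq_square algebra_simps)
  qed
qed

section \<open>The divisor sum recurrence\<close>

definition divisor_sum :: "nat \<Rightarrow> int" where
  "divisor_sum k = (\<Sum>i | i \<in> {1..k} \<and> i dvd k. int i)"

lemma divisor_sum_nonneg: "0 \<le> divisor_sum k"
  by (simp add: divisor_sum_def sum_nonneg)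

lemma divisor_sum_le: "2 * divisor_sum k \<le> int k * (int k + 1)"
proof -
  have "divisor_sum k \<le> (\<Sum>i\<in>{1..k}. int i)"
    unfolding divisor_sum_def by (rule sum_mono2) auto
  also have "2 * \<dots> = int k * (int k + 1)"
    by (induction k) (auto simp: algebra_simps)
  finally show ?thesis by simp
qed

text \<open>Passing to multisets allows a part to be removed or added without regard to its
  position.\<close>

lemma bij_betw_mset_partitions_of:
  "bij_betw mset (partitions_of n) {M. 0 \<notin># M \<and> \<Sum>\<^sub># M = n}"
proof (rule bij_betwI[where g =  "rev \<circ> sorted_list_of_multiset"])
  show "mset \<in> partitions_of n \<rightarrow> {M. 0 \<notin># M \<and> \<Sum>\<^sub># M = n}"
    by (auto simp: partitions_of_def sum_mset_sum_list)
  have sw: "sorted_wrt (\<ge>) xs \<longleftrightarrow> sorted (rev xs)" for xs :: "nat list"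
    by (simp add: sorted_wrt_rev)
  show "rev \<circ> sorted_list_of_multiset \<in> {M. 0 \<notin># M \<and> \<Sum>\<^sub># M = n} \<rightarrow> partitions_of n"
    by (auto simp: partitions_of_def sw sum_mset_sum_list[symmetric] intro: gr0I)
  show "(rev \<circ> sorted_list_of_multiset) (mset p) = p" if "p \<in> partitions_of n" for p
  proof -
    have "sort p = rev p"
      using that by (intro properties_for_sort) (auto simp: partitions_of_def sw)
    then show ?thesis by simp
  qed
  show "mset ((rev \<circ> sorted_list_of_multiset) M) = M" for M :: "nat multiset"
    by simp
qed

text \<open>Removing one copy of \<open>i\<close> gives T(n) = T(n-i) + p(n-i) for the total number
  T of occurrences of \<open>i\<close>; iterating runs through the multiples of
  \<open>i\<close>.\<close>

lemma sum_count_partitions: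
  assumes "0 < i"
  shows "(\<Sum>p\<in>partitions_of n. int (count_list p i)) = (\<Sum>k | k \<in> {1..n} \<and> i dvd k. npart (n - k))"
proof (induction n rule: less_induct)
  case (less n)
  define mp where "mp n = {M :: nat multiset. 0 \<notin># M \<and> \<Sum>\<^sub># M = n}" for n
  define T where "T n = (\<Sum>p\<in>partitions_of n. int (count_list p i))" for n
  have bij: "bij_betw mset (partitions_of n) (mp n)" for n
    unfolding mp_def by (rule bij_betw_mset_partitions_of)
  have fin: "finite (mp n)" for n
    using bij finite_partitions_of bij_betw_finite by blast
  have card: "int (card (mp n)) = npart n" for n
    using bij_betw_same_card[OF bij] by (simp add: npart_def)
  have T: "T n = (\<Sum>M\<in>mp n. int (count M i))" for n
    using sum.reindex_bij_betw[OF bij, of "\<lambda>M. int (count M i)" n] by (simp add: T_def count_mset)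
  show ?case
  proof (cases "i \<le> n")
    case False
    then have "count_list p i = 0" if "p \<in> partitions_of n" for p
      using that member_le_sum_list[of i p] by (auto simp: partitions_of_def count_list_0_iff)
    moreover have "(\<Sum>k | k \<in> {1..n} \<and> i dvd k. npart (n - k)) = 0"
      using False by (intro sum.neutral) (auto dest: dvd_imp_le)
    ultimately show ?thesis by simp
  next
    case True
    have img: "{M \<in> mp n. i \<in># M} = add_mset i ` mp (n - i)"
    proof (intro equalityI subsetI)
      fix M assume M: "M \<in> {M \<in> mp n. i \<in># M}"
      then obtain N where "M = add_mset i N" by (auto dest: multi_member_split)
      then show "M \<in> add_mset i ` mp (n - i)" using M by (auto simp: mp_def)
    qed (use True assms in \<open>auto simp: mp_def\<close>)
    have "T n = (\<Sum>M\<in>{M \<in> mp n. i \<in># M}. int (count M i))"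
      unfolding T by (rule sum.mono_neutral_right) (auto simp: fin not_in_iff)
    also have "\<dots> = (\<Sum>M\<in>mp (n - i). 1 + int (count M i))"
      unfolding img by (subst sum.reindex) (auto simp: inj_on_def)
    also have "\<dots> = T (n - i) + npart (n - i)"
      by (simp add: sum.distrib T card)
    also have "T (n - i) = (\<Sum>k | k \<in> {1..n - i} \<and> i dvd k. npart (n - i - k))"
      unfolding T_def using True assms by (intro less.IH) auto
    also have "\<dots> = (\<Sum>k\<in>(\<lambda>k. k + i) ` {k. k \<in> {1..n - i} \<and> i dvd k}. npart (n - k))"
      by (subst sum.reindex) (auto simp: algebra_simps)
    also have "\<dots> + npart (n - i) =
        (\<Sum>k\<in>insert i ((\<lambda>k. k + i) ` {k. k \<in> {1..n - i} \<and> i dvd k}). npart (n - k))"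
      by (subst sum.insert) auto
    also have "insert i ((\<lambda>k. k + i) ` {k. k \<in> {1..n - i} \<and> i dvd k}) =
        {k. k \<in> {1..n} \<and> i dvd k}"
    proof (intro equalityI subsetI)
      fix k assume k: "k \<in> {k. k \<in> {1..n} \<and> i dvd k}"
      then have "k = i \<or> i < k" by (auto dest: dvd_imp_le)
      moreover have "k \<in> (\<lambda>k. k + i) ` {k. k \<in> {1..n - i} \<and> i dvd k}" if "i < k"
        using k that by (intro image_eqI[of _ _ "k - i"]) auto
      ultimately show "k \<in> insert i ((\<lambda>k. k + i) ` {k. k \<in> {1..n - i} \<and> i dvd k})" by blast
    qed (use True assms in auto)
    finally show ?thesis by (simp add: T_def)
  qed
qed

text \<open>Double counting of the sum of all parts of all partitions of \<open>n\<close>: first by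
  the value \<open>i\<close> of the part, then by the multiple \<open>k\<close> of \<open>i\<close>
  supplied by \<open>sum_count_partitions\<close>.\<close>

lemma npart_recurrence:
  "int n * npart n = (\<Sum>k\<in>{1..n}. divisor_sum k * npart (n - k))"
proof -
  have size: "int n = (\<Sum>i\<in>{1..n}. int i * int (count_list p i))" if p: "p \<in> partitions_of n" for p
  proof -
    have "n = sum_list (map (\<lambda>x. x) p)" using p by (simp add: partitions_of_def)
    also have "\<dots> = (\<Sum>x\<in>set p. count_list p x * x)"
      by (rule sum_list_map_eq_sum_count)
    also have "\<dots> = (\<Sum>x\<in>{1..n}. count_list p x * x)"
      using p member_le_sum_list[of _ p]
      by (intro sum.mono_neutral_left) (auto simp: partitions_of_def Suc_le_eq count_list_0_iff)
    finally show ?thesis by (simp add: mult.commute flip: of_nat_mult of_nat_sum)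
  qed
  have "int n * npart n = (\<Sum>p\<in>partitions_of n. int n)"
    by (simp add: npart_def)
  also have "\<dots> = (\<Sum>p\<in>partitions_of n. \<Sum>i\<in>{1..n}. int i * int (count_list p i))"
    by (intro sum.cong refl size)
  also have "\<dots> = (\<Sum>i\<in>{1..n}. int i * (\<Sum>p\<in>partitions_of n. int (count_list p i)))"
    by (subst sum.swap) (simp add: sum_distrib_left)
  also have "\<dots> = (\<Sum>i\<in>{1..n}. \<Sum>k | k \<in> {1..n} \<and> i dvd k. int i * npart (n - k))"
    by (intro sum.cong refl) (simp add: sum_count_partitions sum_distrib_left)
  also have "\<dots> = (\<Sum>k\<in>{1..n}. \<Sum>i | i \<in> {1..n} \<and> i dvd k. int i * npart (n - k))"
    by (rule sum.swap_restrict) auto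
  also have "\<dots> = (\<Sum>k\<in>{1..n}. divisor_sum k * npart (n - k))"
  proof (rule sum.cong[OF refl])
    fix k assume k: "k \<in> {1..n}"
    then have "{i. i \<in> {1..n} \<and> i dvd k} = {i. i \<in> {1..k} \<and> i dvd k}"
      by (auto dest: dvd_imp_le)
    then show "(\<Sum>i | i \<in> {1..n} \<and> i dvd k. int i * npart (n - k)) = divisor_sum k * npart (n - k)"
      by (simp add: divisor_sum_def sum_distrib_right)
  qed
  finally show ?thesis .
qed

section \<open>Product inequalities\<close>

lemma npart_0: "npart 0 = 1"
  by (simp add: npart_def partitions_of_0)

lemma npart_pos: "0 < npart n"
  using npart_mono[of 0 n] npart_0 by simp

lemma npart_ratio:
  assumes "38 \<le> n"
  shows "5 * npart (Suc n) \<le> 6 * npart n"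
  using assms
proof (induction n rule: less_induct)
  case (less n)
  show ?case
  proof (cases "n < 72")
    case True
    then show ?thesis
      using npart_checks(1) less.prems by simp
  next
    case False
    \<comment> \<open>\<open>h\<close> is the excess over the ratio bound. By induction only the
      indices below 38 contribute, and \<open>S / 2\<close> bounds every divisor sum
      involved.\<close>
    define h where "h i = max 0 (5 * npart (Suc i) - 6 * npart i)" for i
    define S where "S = (int n + 1) * (int n + 2)"
    have h_nonneg: "0 \<le> h i" for i by (simp add: h_def)
    have S_nonneg: "0 \<le> S" by (simp add: S_def)
    have dS: "2 * divisor_sum k \<le> S" if "k \<le> Suc n" for k
    proof -
      have "int k * (int k + 1) \<le> S"
        unfolding S_def using that by (intro mult_mono) auto
      then show ?thesis using divisor_sum_le[of k] by linarith
    qed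
    have h_sum: "(\<Sum>i<38. h i) = 9301"
      using npart_excess_sum by (simp add: h_def atLeast0LessThan)
    have summand: "2 * (divisor_sum k * (5 * npart (Suc n - k) - 6 * npart (n - k)))
        \<le> S * (if n - k < 38 then h (n - k) else 0)" if k: "k \<in> {1..n}" for k
    proof -
      have Suc: "Suc n - k = Suc (n - k)" using k by auto
      have "5 * npart (Suc (n - k)) - 6 * npart (n - k) \<le> (if n - k < 38 then h (n - k) else 0)"
        using less.IH[of "n - k"] k by (auto simp: h_def)
      then have "2 * divisor_sum k * (5 * npart (Suc n - k) - 6 * npart (n - k))
        \<le> 2 * divisor_sum k * (if n - k < 38 then h (n - k) else 0)"
        unfolding Suc by (intro mult_left_mono) (simp_all add: divisor_sum_nonneg)
      also have "\<dots> \<le> S * (if n - k < 38 then h (n - k) else 0)"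
        using dS[of k] k by (intro mult_right_mono) (simp_all add: h_nonneg)
      finally show ?thesis by (simp only: mult.assoc)
    qed
    have "(\<Sum>k\<in>{1..n}. if n - k < 38 then h (n - k) else 0) = (\<Sum>i\<in>{..<n}. if i < 38 then h i else 0)"
      by (rule sum.reindex_bij_witness[of _ "\<lambda>i. n - i" "\<lambda>k. n - k"]) auto
    also have "\<dots> = (\<Sum>i<38. h i)"
      using False by (intro sum.mono_neutral_cong_right) auto
    finally have h_sum': "(\<Sum>k\<in>{1..n}. if n - k < 38 then h (n - k) else 0) = 9301"
      using h_sum by simp
    \<comment> \<open>Difference of the recurrences at \<open>Suc n\<close> and \<open>n\<close>;
      the unmatched term \<open>k = Suc n\<close> contributes
      \<open>5 * divisor_sum (Suc n)\<close>.\<close>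
    have "5 * (int (Suc n) * npart (Suc n)) - 6 * (int n * npart n) =
        (\<Sum>k\<in>{1..n}. divisor_sum k * (5 * npart (Suc n - k) - 6 * npart (n - k))) +
        5 * divisor_sum (Suc n)"
      unfolding npart_recurrence by (simp add: npart_0 sum_distrib_left sum_subtractf algebra_simps)
    then have "2 * (5 * (int (Suc n) * npart (Suc n)) - 6 * (int n * npart n)) =
        (\<Sum>k\<in>{1..n}. 2 * (divisor_sum k * (5 * npart (Suc n - k) - 6 * npart (n - k)))) +
        5 * (2 * divisor_sum (Suc n))"
      by (simp add: sum_distrib_left)
    also have "\<dots> \<le> (\<Sum>k\<in>{1..n}. S * (if n - k < 38 then h (n - k) else 0)) + 5 * S"
      using dS[of "Suc n"] by (intro add_mono sum_mono summand) auto
    \<comment> \<open>9306 = 9301 + 5.\<close>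
    also have "\<dots> = 9306 * S"
      using h_sum' by (simp flip: sum_distrib_left)
    also have "S \<le> int n * int n + 3 * int n + 2"
      by (simp add: S_def algebra_simps)
    finally have "2 * (5 * (int (Suc n) * npart (Suc n)) - 6 * (int n * npart n)) \<le>
        9306 * (int n * int n + 3 * int n + 2)"
      by simp
    \<comment> \<open>The goal, multiplied by 2(n+1), leaves room for an error of 12 p(n), because
      the left side carries n p(n) instead of (n+1) p(n).\<close>
    also have "\<dots> \<le> 12 * (1000 * (int n)\<^sup>2)"
    proof -
      have "72 * int n \<le> (int n)\<^sup>2"
        using False unfolding power2_eq_square by (intro mult_right_mono) auto
      then show ?thesis using False by (simp flip: power2_eq_square)
    qed
    also have "\<dots> \<le> 12 * npart n"
      using npart_ge_quadratic[of n] False by simp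
    finally have "int (Suc n) * (5 * npart (Suc n)) \<le> int (Suc n) * (6 * npart n)"
      by (simp add: algebra_simps)
    then show ?thesis by simp
  qed
qed

lemma npart_add_le:
  assumes "38 \<le> n"
  shows "5 ^ m * npart (n + m) \<le> 6 ^ m * npart n"
proof (induction m)
  case (Suc m)
  have "5 ^ Suc m * npart (n + Suc m) = 5 ^ m * (5 * npart (Suc (n + m)))" by simp
  also have "\<dots> \<le> 5 ^ m * (6 * npart (n + m))"
    using assms by (intro mult_left_mono npart_ratio) auto
  also have "\<dots> \<le> 6 ^ Suc m * npart n" using Suc by simp
  finally show ?case .
qed simp

text \<open>Twice this quadratic is 6b(b+1) + 18b(2b+1), the error per unit of \<open>a\<close> in
  \<open>npart_product\<close>.\<close>

lemma npart_gt_quadratic: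
  assumes "40 \<le> b"
  shows "21 * (int b)\<^sup>2 + 12 * int b < npart b"
proof (cases "b < 72")
  case True
  then show ?thesis using assms npart_checks(2) by simp
next
  case False
  then have "72 * int b \<le> (int b)\<^sup>2"
    unfolding power2_eq_square by (intro mult_right_mono) auto
  then have "21 * (int b)\<^sup>2 + 12 * int b < 1000 * (int b)\<^sup>2"
    using False by simp
  also have "\<dots> \<le> npart b" using False by (intro npart_ge_quadratic) auto
  finally show ?thesis .
qed

text \<open>By \<open>npart_add_le\<close> it suffices to compare 9 (6/5)^i with p(i). From 13 on
  p(i) is larger; below 13 the deficit is at most 18, the worst case being i = 7.\<close>

lemma npart_product_small:
  assumes "40 \<le> a" "i < 40"
  shows "13 \<le> i \<Longrightarrow> 9 * npart (a + i) < npart a * npart i"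
    and "i < 13 \<Longrightarrow> 9 * npart (a + i) \<le> npart a * (npart i + 18)"
proof -
  have *: "5 ^ i * (9 * npart (a + i)) \<le> 9 * 6 ^ i * npart a"
    using npart_add_le[of a i] assms by simp
  show "9 * npart (a + i) < npart a * npart i" if "13 \<le> i"
  proof -
    have "9 * 6 ^ i < 5 ^ i * npart i"
      using npart_checks(4) that assms by simp
    then have "9 * 6 ^ i * npart a < 5 ^ i * npart i * npart a"
      by (intro mult_strict_right_mono npart_pos)
    also note mult.assoc
    finally have "5 ^ i * (9 * npart (a + i)) < 5 ^ i * (npart i * npart a)"
      using * by (rule le_less_trans[rotated])
    then show ?thesis by (simp add: mult.commute)
  qed
  show "9 * npart (a + i) \<le> npart a * (npart i + 18)" if "i < 13"
  proof -
    have "9 * 6 ^ i \<le> 5 ^ i * (npart i + 18)"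
      using npart_checks(3) that by simp
    then have "9 * 6 ^ i * npart a \<le> 5 ^ i * (npart i + 18) * npart a"
      using npart_pos[of a] by (intro mult_right_mono) auto
    also note mult.assoc
    finally have "5 ^ i * (9 * npart (a + i)) \<le> 5 ^ i * ((npart i + 18) * npart a)"
      using * by (rule order_trans[rotated])
    then show ?thesis by (simp add: mult.commute)
  qed
qed

lemma npart_product:
  assumes "40 \<le> a" "13 \<le> b"
  shows "9 * npart (a + b) < npart a * npart b"
  using assms
proof (induction "a + b" arbitrary: a b rule: less_induct)
  case less
  \<comment> \<open>The recurrence at \<open>a + b\<close> is compared with \<open>npart a\<close>
    times the recurrence at \<open>b\<close>. The comparison yields b p(a) p(b), and the missing a
    p(a) p(b) has to absorb the errors. Taking \<open>a \<le> b\<close> makes them quadratic in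
    \<open>b\<close> per unit of \<open>a\<close>.\<close>
  have main: "9 * npart (a + b) < npart a * npart b"
    if ab: "40 \<le> a" "a \<le> b"
      and IH: "\<And>i. 13 \<le> i \<Longrightarrow> i < b \<Longrightarrow> 9 * npart (a + i) < npart a * npart i" for a b
  proof -
    define S where "S = int b * (int b + 1)"
    have dS: "2 * divisor_sum k \<le> S" if "k \<le> b" for k
    proof -
      have "int k * (int k + 1) \<le> S"
        unfolding S_def using that by (intro mult_mono) auto
      then show ?thesis using divisor_sum_le[of k] by linarith
    qed
    have dS': "2 * divisor_sum k \<le> 2 * int b * (2 * int b + 1)" if "k \<le> a + b" for k
    proof -
      have "int k * (int k + 1) \<le> 2 * int b * (2 * int b + 1)"
        using that ab by (intro mult_mono) auto
      then show ?thesis using divisor_sum_le[of k] by linarith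
    qed
    \<comment> \<open>Terms with \<open>b - k \<ge> 13\<close> satisfy the product inequality by
      \<open>IH\<close>; each of the other 13 costs at most \<open>18 * S * npart a\<close>, in
      total 234 = 13 * 18 times \<open>S * npart a\<close>.\<close>
    have low: "2 * (divisor_sum k * (9 * npart (a + b - k))) \<le>
        2 * (npart a * (divisor_sum k * npart (b - k))) + (if b - k < 13 then 18 * S * npart a else 0)"
      if k: "k \<in> {1..b}" for k
    proof -
      let ?e = "if b - k < 13 then 18 else 0"
      have eq: "a + b - k = a + (b - k)" using k by auto
      have "9 * npart (a + (b - k)) \<le> npart a * (npart (b - k) + ?e)"
        using IH[of "b - k"] npart_product_small(2)[of a "b - k"] k ab by force
      then have "2 * divisor_sum k * (9 * npart (a + (b - k))) \<le>
          2 * divisor_sum k * (npart a * (npart (b - k) + ?e))"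
        by (intro mult_left_mono) (simp_all add: divisor_sum_nonneg)
      also have "\<dots> = 2 * (npart a * (divisor_sum k * npart (b - k))) + 2 * divisor_sum k * (npart a * ?e)"
        by (simp add: algebra_simps)
      also have "2 * divisor_sum k * (npart a * ?e) \<le> S * (npart a * ?e)"
        using dS[of k] k npart_pos[of a] by (intro mult_right_mono) auto
      also have "S * (npart a * ?e) = (if b - k < 13 then 18 * S * npart a else 0)"
        by simp
      finally show ?thesis unfolding eq by (simp only: mult.assoc)
    qed
    have "(\<Sum>k\<in>{1..b}. if b - k < 13 then 18 * S * npart a else 0) =
        (\<Sum>i\<in>{..<b}. if i < 13 then 18 * S * npart a else 0)"
      by (rule sum.reindex_bij_witness[of _ "\<lambda>i. b - i" "\<lambda>k. b - k"]) auto
    also have "\<dots> = (\<Sum>i<(13::nat). 18 * S * npart a)"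
      using ab by (intro sum.mono_neutral_cong_right) auto
    finally have excess: "(\<Sum>k\<in>{1..b}. if b - k < 13 then 18 * S * npart a else 0) = 234 * S * npart a"
      by simp
    \<comment> \<open>These terms have no counterpart in the recurrence at \<open>b\<close> and
      count entirely as error.\<close>
    have high: "2 * (divisor_sum k * (9 * npart (a + b - k))) \<le> 18 * int b * (2 * int b + 1) * npart a"
      if k: "k \<in> {b + 1..a + b}" for k
    proof -
      have "npart (a + b - k) \<le> npart a" using k by (intro npart_mono) auto
      then have "2 * divisor_sum k * (9 * npart (a + b - k)) \<le>
          2 * int b * (2 * int b + 1) * (9 * npart a)"
        using dS'[of k] k npart_pos[of "a + b - k"] by (intro mult_mono[of "2 * divisor_sum k"]) auto
      then show ?thesis by simp
    qed
    have "2 * (int (a + b) * (9 * npart (a + b))) = 18 * (\<Sum>k\<in>{1..a + b}. divisor_sum k * npart (a + b - k))"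
      unfolding npart_recurrence[symmetric] by simp
    also have "\<dots> = (\<Sum>k\<in>{1..a + b}. 2 * (divisor_sum k * (9 * npart (a + b - k))))"
      by (simp add: sum_distrib_left mult_ac)
    also have "{1..a + b} = {1..b} \<union> {b + 1..a + b}" by auto
    also have "(\<Sum>k\<in>{1..b} \<union> {b + 1..a + b}. 2 * (divisor_sum k * (9 * npart (a + b - k)))) =
        (\<Sum>k\<in>{1..b}. 2 * (divisor_sum k * (9 * npart (a + b - k)))) +
        (\<Sum>k\<in>{b + 1..a + b}. 2 * (divisor_sum k * (9 * npart (a + b - k))))"
      by (rule sum.union_disjoint) auto
    also have "\<dots> \<le> (\<Sum>k\<in>{1..b}. 2 * (npart a * (divisor_sum k * npart (b - k))) +
          (if b - k < 13 then 18 * S * npart a else 0)) +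
        (\<Sum>k\<in>{b + 1..a + b}. 18 * int b * (2 * int b + 1) * npart a)"
      by (intro add_mono sum_mono low high)
    also have "\<dots> = 2 * (npart a * (\<Sum>k\<in>{1..b}. divisor_sum k * npart (b - k))) +
        234 * S * npart a + int a * (18 * int b * (2 * int b + 1) * npart a)"
      by (simp add: sum.distrib excess sum_distrib_left del: One_nat_def)
    also have "\<dots> = 2 * (npart a * (int b * npart b)) +
        npart a * (234 * S + int a * (18 * int b * (2 * int b + 1)))"
      by (simp add: npart_recurrence algebra_simps)
    also have "\<dots> < 2 * (npart a * (int b * npart b)) + npart a * (2 * int a * npart b)"
    proof -
      have "0 \<le> S" by (simp add: S_def)
      moreover have "40 * S \<le> int a * S" using ab by (intro mult_right_mono) (auto simp: S_def)
      \<comment> \<open>As \<open>a \<ge> 40\<close>, 234 S is below 240 S, which is at most 6 a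
        S.\<close>
      ultimately have "234 * S \<le> int a * (6 * S)" by linarith
      then have "234 * S + int a * (18 * int b * (2 * int b + 1)) \<le>
          int a * (6 * S) + int a * (18 * int b * (2 * int b + 1))"
        by simp
      also have "\<dots> = int a * (2 * (21 * (int b)\<^sup>2 + 12 * int b))"
        by (simp add: S_def power2_eq_square algebra_simps)
      also have "\<dots> < int a * (2 * npart b)"
        using npart_gt_quadratic[of b] ab by (intro mult_strict_left_mono) auto
      finally show ?thesis
        using npart_pos[of a] by (intro add_strict_left_mono mult_strict_left_mono) (simp_all add: mult_ac)
    qed
    also have "\<dots> = 2 * (int (a + b) * (npart a * npart b))"
      by (simp add: algebra_simps)
    finally have "int (a + b) * (9 * npart (a + b)) < int (a + b) * (npart a * npart b)"
      by linarith
    then show ?thesis by (rule mult_left_less_imp_less) simp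
  qed
  show ?case
  proof (cases "b < 40")
    case True
    then show ?thesis using less.prems by (intro npart_product_small(1)) auto
  next
    case False
    show ?thesis
    proof (cases "a \<le> b")
      case True
      show ?thesis
      proof (rule main[OF less.prems(1) True])
        show "9 * npart (a + i) < npart a * npart i" if "13 \<le> i" "i < b" for i
          using that less.prems by (intro less.hyps) auto
      qed
    next
      case False
      \<comment> \<open>Both arguments are at least 40, so their roles may be exchanged.\<close>
      have "9 * npart (b + a) < npart b * npart a"
      proof (rule main)
        show "40 \<le> b" "b \<le> a" using \<open>\<not> b < 40\<close> False by auto
        show "9 * npart (b + i) < npart b * npart i" if "13 \<le> i" "i < a" for i
          using that \<open>40 \<le> b\<close> by (intro less.hyps) auto
      qed
      then show ?thesis by (simp add: ac_simps)
    qed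
  qed
qed

section \<open>Products of rank classes\<close>

lemma nrank_bounds:
  assumes "40 \<le> n" "r \<in> {0, 1, 2}"
  shows "2 * npart n \<le> 9 * nrank r n" "9 * nrank r n \<le> 4 * npart n"
proof -
  have *: "\<bar>3 * nrank r n - npart n\<bar> \<le> 2 * (npart n - npart (n - 1))"
    using assms by (intro nrank_near_third) auto
  have **: "5 * npart n \<le> 6 * npart (n - 1)"
    using npart_ratio[of "n - 1"] assms(1) by simp
  \<comment> \<open>The ratio bound gives p(n) - p(n-1) \<le> p(n)/6, so three times the class
    differs from p(n) by at most p(n)/3.\<close>
  show "2 * npart n \<le> 9 * nrank r n" "9 * nrank r n \<le> 4 * npart n"
    using * ** by (smt (verit))+
qed

lemma nrank_product:
  assumes "r \<in> {0, 1, 2}" "(if r = 0 then 12 else 11) \<le> a" "(if r = 0 then 12 else 11) \<le> b"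
  shows "nrank r (a + b) < nrank r a * nrank r b"
proof -
  \<comment> \<open>With A for class \<open>r\<close>: 9 A(a+b) \<le> 4 p(a+b) \<le> 4 (6/5)^a p(b)
    < 2 A(a) p(b) \<le> 9 A(a) A(b).\<close>
  have mixed: "nrank r (a + b) < nrank r a * nrank r b"
    if a: "(if r = 0 then 12 else 11) \<le> a" "a < 40" and b: "40 \<le> b" for a b
  proof -
    have "2 * 6 ^ a < 5 ^ a * nrank r a"
      using nrank_checks a assms(1) by auto
    then have "2 * 6 ^ a * (2 * npart b) < 5 ^ a * nrank r a * (2 * npart b)"
      using npart_pos[of b] by (intro mult_strict_right_mono) auto
    also have "\<dots> \<le> 5 ^ a * nrank r a * (9 * nrank r b)"
      using nrank_bounds(1)[OF b assms(1)] by (intro mult_left_mono) (auto simp: nrank_def)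
    finally have "4 * (6 ^ a * npart b) < 5 ^ a * (9 * (nrank r a * nrank r b))"
      by (simp add: mult_ac)
    moreover have "5 ^ a * (9 * nrank r (a + b)) \<le> 5 ^ a * (4 * npart (b + a))"
      using nrank_bounds(2)[of "a + b" r] b assms(1) by (intro mult_left_mono) (auto simp: add.commute)
    moreover have "5 ^ a * npart (b + a) \<le> 6 ^ a * npart b"
      using b by (intro npart_add_le) auto
    ultimately have "5 ^ a * (9 * nrank r (a + b)) < 5 ^ a * (9 * (nrank r a * nrank r b))"
      by linarith
    then show ?thesis by simp
  qed
  consider "a < 40" "b < 40" | "a < 40" "40 \<le> b" | "40 \<le> a" "b < 40" | "40 \<le> a" "40 \<le> b"
    by linarith
  then show ?thesis
  proof cases
    case 1
    then show ?thesis
      using nrank_product_checks assms by auto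
  next
    case 2
    then show ?thesis using mixed assms by simp
  next
    case 3
    then show ?thesis using mixed[of b a] assms by (simp add: ac_simps)
  next
    case 4
    \<comment> \<open>The upper bound 4/9 is 9 times the product (2/9)^2 of the lower bounds, which
      is why \<open>npart_product\<close> carries the factor 9.\<close>
    have "9 * (9 * nrank r (a + b)) \<le> 4 * (9 * npart (a + b))"
      using nrank_bounds(2)[of "a + b" r] 4 assms(1) by simp
    also have "\<dots> < 2 * npart a * (2 * npart b)"
      using npart_product[of a b] 4 by simp
    also have "\<dots> \<le> 9 * nrank r a * (9 * nrank r b)"
      using npart_pos[of b]
      by (intro mult_mono[OF nrank_bounds(1)[OF 4(1) assms(1)] nrank_bounds(1)[OF 4(2) assms(1)]])
        (simp_all add: nrank_def)
    finally show ?thesis by simp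
  qed
qed

theorem theorem1p1:
  shows "(\<forall>a b :: nat. a \<ge> 12 \<and> b \<ge> 12 \<longrightarrow>
            rank_count 0 3 a * rank_count 0 3 b > rank_count 0 3 (a + b)) \<and>
         (\<forall>r \<in> {1, 2 :: int}. \<forall>a b :: nat. a \<ge> 11 \<and> b \<ge> 11 \<longrightarrow>
            rank_count r 3 a * rank_count r 3 b > rank_count r 3 (a + b))"
proof -
  have "rank_count r 3 (a + b) < rank_count r 3 a * rank_count r 3 b"
    if "r \<in> {0, 1, 2}" "(if r = 0 then 12 else 11) \<le> a" "(if r = 0 then 12 else 11) \<le> b" for r a b
    using nrank_product[OF that] by (simp add: nrank_def flip: of_nat_mult)
  then show ?thesis by auto
qed

end
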